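(* Let $x(t)$ be an ergodic, stationary solution on a manifold $\mathcal{M}\subset\mathbb{R}^n$ of the stochastic differential equation $dx = a(x)\,dt + b(x)\,dW_t$, where $a$ is a vector field and $b$ a diffusion tensor on $\mathcal{M}$, with generator $\mathcal{L}$ and invariant density $p_{\rm eq}$. Let $x_i=x(t_i)$, $i=1,\dots,N+1$, be the values of the solution at discrete times with $t_{i+1}-t_i=\tau>0$ for all $i$, so that each $x_i$ is distributed according to $p_{\rm eq}$. Let $\{\varphi_j\}_{j\ge1}$ be the real eigenfunctions, forming an orthonormal basis of $L^2(\mathcal{M},p_{\rm eq})$, of the operator $\hat{\mathcal{L}}=\Delta-\nabla U\cdot\nabla$ with $U=-\log p_{\rm eq}$. For $l,j\ge1$ define $$A_{lj}(\tau)=\langle \varphi_j, e^{\tau\mathcal{L}}\varphi_l\rangle_{p_{\rm eq}},\qquad \hat A_{lj}=\frac1N\sum_{i=1}^N \varphi_j(x_i)\,\varphi_l(x_{i+1}).$$ Then $\hat A_{lj}$ is an unbiased estimate of $A_{lj}(\tau)$, that is, $$\mathbb{E}[\hat A_{lj}] = A_{lj}(\tau)\qquad\text{for all } l,j\ge1.$$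
   Context: $W_t$ is a standard Brownian motion. The generator of the equation is $\mathcal{L}f = a\cdot\nabla f + \tfrac12\mathrm{Tr}(b^\top \mathrm{H}(f)\, b)$, where $\mathrm{H}(f)$ is the Hessian of $f$. All densities are with respect to the volume form $dV$ that $\mathcal{M}$ inherits from $\mathbb{R}^n$; $\langle f,g\rangle_{p_{\rm eq}}=\int_{\mathcal{M}} f g\,p_{\rm eq}\,dV$ is the inner product of $L^2(\mathcal{M},p_{\rm eq})$. $\Delta$ is the Laplacian on $\mathcal{M}$ (negative semi-definite), and $\nabla$ is the gradient on $\mathcal{M}$. The semigroup solution $e^{t\mathcal{L}}f$ is the solution $u(\cdot,t)$ of $\partial_t u=\mathcal{L}u$, $u(\cdot,0)=f$, which has the (standard, Feynman--Kac) representation $e^{t\mathcal{L}}f(x)=\mathbb{E}[f(x(s+t))\mid x(s)=x]$; this representation may be used as the definition of $e^{t\mathcal{L}}$. The expectation $\mathbb{E}[\hat A_{lj}]$ is over the stationary process $x(t)$. *)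

theory Defs
  imports "HOL-Probability.Probability"
begin

section \<open>Calculus on an embedded submanifold of Euclidean space\<close>

text \<open>\<open>C_k_on k f S\<close> is meant for open \<open>S\<close>.\<close>

fun C_k_on :: "nat \<Rightarrow> ('a::euclidean_space \<Rightarrow> 'b::real_normed_vector) \<Rightarrow> 'a set \<Rightarrow> bool" where
  "C_k_on 0 f S \<longleftrightarrow> continuous_on S f"
| "C_k_on (Suc k) f S \<longleftrightarrow>
     f differentiable_on S \<and> (\<forall>v. C_k_on k (\<lambda>x. frechet_derivative f (at x) v) S)"

definition local_parametrization ::
  "(real^'n) set \<Rightarrow> (real^'d) set \<Rightarrow> (real^'d \<Rightarrow> real^'n) \<Rightarrow> bool" where
  "local_parametrization M V \<psi> \<longleftrightarrow>
     open V \<and> \<psi> ` V \<subseteq> M \<and> openin (top_of_set M) (\<psi> ` V) \<and>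
     (\<exists>\<psi>'. homeomorphism V (\<psi> ` V) \<psi> \<psi>') \<and>
     (\<forall>k. C_k_on k \<psi> V) \<and>
     (\<forall>y\<in>V. inj (frechet_derivative \<psi> (at y)))"

text \<open>Smooth embedded submanifolds (without boundary) of dimension \<open>CARD('d)\<close>.\<close>

definition embedded_submanifold :: "'d::finite itself \<Rightarrow> (real^'n) set \<Rightarrow> bool" where
  "embedded_submanifold D M \<longleftrightarrow>
     (\<forall>p\<in>M. \<exists>V (\<psi> :: real^'d \<Rightarrow> real^'n). local_parametrization M V \<psi> \<and> p \<in> \<psi> ` V)"

definition C_k_manifold ::
  "nat \<Rightarrow> (real^'n) set \<Rightarrow> (real^'n \<Rightarrow> 'b::real_normed_vector) \<Rightarrow> bool" where
  "C_k_manifold k M f \<longleftrightarrow>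
     (\<forall>p\<in>M. \<exists>O' F. open O' \<and> p \<in> O' \<and> C_k_on k F O' \<and> (\<forall>q\<in>O' \<inter> M. F q = f q))"

text \<open>The measure on the Borel sets of \<open>M\<close> that in every local parametrization is
  \<open>sqrt (det g) dy\<close>, where \<open>g\<close> is the metric induced from the ambient space. The charts
  cover \<open>M\<close>, so these conditions determine the measure.\<close>

definition riemannian_volume :: "'d::finite itself \<Rightarrow> (real^'n) set \<Rightarrow> (real^'n) measure \<Rightarrow> bool" where
  "riemannian_volume D M dV \<longleftrightarrow>
     space dV = M \<and> sets dV = sets (restrict_space borel M) \<and>
     (\<forall>V (\<psi> :: real^'d \<Rightarrow> real^'n). local_parametrization M V \<psi> \<longrightarrow>
       (\<forall>A\<in>sets dV. A \<subseteq> \<psi> ` V \<longrightarrow>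
         emeasure dV A =
           (\<integral>\<^sup>+y\<in>{y \<in> V. \<psi> y \<in> A}.
              (let J = matrix (frechet_derivative \<psi> (at y))
               in ennreal (sqrt (det (transpose J ** J)))) \<partial>lborel)))"

definition tangent_space :: "(real^'n) set \<Rightarrow> real^'n \<Rightarrow> (real^'n) set" where
  "tangent_space M p =
     {v. \<exists>\<gamma>. (\<forall>s. \<gamma> s \<in> M) \<and> \<gamma> 0 = p \<and> (\<gamma> has_vector_derivative v) (at 0)}"

text \<open>For a linear subspace \<open>S\<close>, \<open>closest_point S\<close> is the orthogonal projection onto \<open>S\<close>.\<close>

definition tangent_proj :: "(real^'n) set \<Rightarrow> real^'n \<Rightarrow> real^'n \<Rightarrow> real^'n" where
  "tangent_proj M p v = closest_point (tangent_space M p) v"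

text \<open>A derivative at \<open>p\<close> within \<open>M\<close> is not unique as a linear map on the ambient space, but
  its restriction to the tangent space is. Below, \<open>frechet_derivative f (at p within M)\<close> is only
  ever applied to tangent vectors.\<close>

definition grad :: "(real^'n) set \<Rightarrow> (real^'n \<Rightarrow> real) \<Rightarrow> real^'n \<Rightarrow> real^'n" where
  "grad M f p =
     (THE v. v \<in> tangent_space M p \<and>
        (\<forall>w\<in>tangent_space M p. frechet_derivative f (at p within M) w = v \<bullet> w))"

text \<open>The Riemannian Hessian: the Levi-Civita connection of the induced metric is the tangential
  part of the ambient derivative. The tangent endomorphism \<open>v \<mapsto> \<nabla>\<^sub>v (grad f)\<close> is
  extended by \<open>0\<close> to the normal space, so that it becomes an \<open>n \<times> n\<close> matrix.\<close>

definition hessian :: "(real^'n) set \<Rightarrow> (real^'n \<Rightarrow> real) \<Rightarrow> real^'n \<Rightarrow> real^'n^'n" where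
  "hessian M f p =
     matrix (\<lambda>v. tangent_proj M p
       (frechet_derivative (grad M f) (at p within M) (tangent_proj M p v)))"

definition laplacian :: "(real^'n) set \<Rightarrow> (real^'n \<Rightarrow> real) \<Rightarrow> real^'n \<Rightarrow> real" where
  "laplacian M f p = trace (hessian M f p)"

section \<open>Brownian motion and the Ito integral\<close>

definition brownian_motion ::
  "'w measure \<Rightarrow> (real \<Rightarrow> 'w measure) \<Rightarrow> (real \<Rightarrow> 'w \<Rightarrow> real^'m) \<Rightarrow> bool" where
  "brownian_motion P F W \<longleftrightarrow>
     (\<forall>t\<ge>0. W t \<in> borel_measurable (F t)) \<and>
     (\<forall>\<omega>\<in>space P. continuous_on {0..} (\<lambda>t. W t \<omega>)) \<and>
     (AE \<omega> in P. W 0 \<omega> = 0) \<and>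
     (\<forall>s t. 0 \<le> s \<and> s < t \<longrightarrow>
        distributed P lborel (\<lambda>\<omega>. W t \<omega> - W s \<omega>)
          (\<lambda>v. ennreal (\<Prod>k\<in>UNIV. normal_density 0 (sqrt (t - s)) (v $ k))) \<and>
        prob_space.indep_set P (sets (F s))
          {(\<lambda>\<omega>. W t \<omega> - W s \<omega>) -` B \<inter> space P | B. B \<in> sets borel})"

text \<open>The simple process with partition points \<open>\<pi> 0 \<le> \<dots> \<le> \<pi> k\<close> of \<open>[0, T]\<close> takes the value
  \<open>\<xi> i \<omega>\<close> on \<open>(\<pi> i, \<pi> (i+1)]\<close>.\<close>

definition simple_integrand ::
  "'w measure \<Rightarrow> (real \<Rightarrow> 'w measure) \<Rightarrow> real \<Rightarrow> nat \<Rightarrow> (nat \<Rightarrow> real) \<Rightarrow>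
   (nat \<Rightarrow> 'w \<Rightarrow> real^'m) \<Rightarrow> bool" where
  "simple_integrand P F T k \<pi> \<xi> \<longleftrightarrow>
     \<pi> 0 = 0 \<and> \<pi> k = T \<and> (\<forall>i<k. \<pi> i \<le> \<pi> (Suc i)) \<and>
     (\<forall>i<k. \<xi> i \<in> borel_measurable (F (\<pi> i))) \<and>
     (\<exists>C. \<forall>i<k. \<forall>\<omega>\<in>space P. norm (\<xi> i \<omega>) \<le> C)"

definition simple_process ::
  "nat \<Rightarrow> (nat \<Rightarrow> real) \<Rightarrow> (nat \<Rightarrow> 'w \<Rightarrow> real^'m) \<Rightarrow> real \<Rightarrow> 'w \<Rightarrow> real^'m" where
  "simple_process k \<pi> \<xi> s \<omega> = (\<Sum>i<k. indicator {\<pi> i<..\<pi> (Suc i)} s *\<^sub>R \<xi> i \<omega>)"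

definition simple_ito_integral ::
  "(real \<Rightarrow> 'w \<Rightarrow> real^'m) \<Rightarrow> nat \<Rightarrow> (nat \<Rightarrow> real) \<Rightarrow> (nat \<Rightarrow> 'w \<Rightarrow> real^'m) \<Rightarrow> 'w \<Rightarrow> real" where
  "simple_ito_integral W k \<pi> \<xi> \<omega> = (\<Sum>i<k. \<xi> i \<omega> \<bullet> (W (\<pi> (Suc i)) \<omega> - W (\<pi> i) \<omega>))"

text \<open>\<open>has_ito_integral P F W T H J\<close>: the random variable \<open>J\<close> is (a version of) the Ito integral
  \<open>\<integral>\<^sub>0\<^sup>T H\<^sub>s \<bullet> dW\<^sub>s\<close>, the limit in probability of the integrals of simple processes \<open>H\<^sup>n\<close> with
  \<open>\<integral>\<^sub>0\<^sup>T |H\<^sup>n\<^sub>s - H\<^sub>s|\<^sup>2 ds \<rightarrow> 0\<close> in probability.\<close>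

definition has_ito_integral ::
  "'w measure \<Rightarrow> (real \<Rightarrow> 'w measure) \<Rightarrow> (real \<Rightarrow> 'w \<Rightarrow> real^'m) \<Rightarrow> real \<Rightarrow>
   (real \<Rightarrow> 'w \<Rightarrow> real^'m) \<Rightarrow> ('w \<Rightarrow> real) \<Rightarrow> bool" where
  "has_ito_integral P F W T H J \<longleftrightarrow>
     (\<forall>s\<in>{0..T}. H s \<in> borel_measurable (F s)) \<and>
     (\<lambda>(s, \<omega>). H s \<omega>) \<in> borel_measurable (restrict_space borel {0..T} \<Otimes>\<^sub>M P) \<and>
     J \<in> borel_measurable P \<and>
     (\<exists>k \<pi> \<xi>.
        (\<forall>n. simple_integrand P F T (k n) (\<pi> n) (\<xi> n)) \<and>
        (\<forall>\<epsilon>>0. (\<lambda>n. measure P {\<omega> \<in> space P.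
            (\<integral>\<^sup>+s\<in>{0..T}. ennreal ((norm (simple_process (k n) (\<pi> n) (\<xi> n) s \<omega> - H s \<omega>))\<^sup>2) \<partial>lborel)
              > ennreal \<epsilon>}) \<longlonglongrightarrow> 0) \<and>
        (\<forall>\<epsilon>>0. (\<lambda>n. measure P {\<omega> \<in> space P.
            \<bar>simple_ito_integral W (k n) (\<pi> n) (\<xi> n) \<omega> - J \<omega>\<bar> > \<epsilon>}) \<longlonglongrightarrow> 0))"

section \<open>Stochastic differential equations on a manifold\<close>

definition generator ::
  "(real^'n) set \<Rightarrow> (real^'n \<Rightarrow> real^'n) \<Rightarrow> (real^'n \<Rightarrow> real^'m^'n) \<Rightarrow>
   (real^'n \<Rightarrow> real) \<Rightarrow> real^'n \<Rightarrow> real" where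
  "generator M a b f p =
     a p \<bullet> grad M f p + 1 / 2 * trace (transpose (b p) ** hessian M f p ** b p)"

text \<open>Solutions of the Ito equation \<open>dx = a(x) dt + b(x) dW\<close> on \<open>M\<close> are defined, as usual for
  manifolds, by testing against smooth functions: \<open>x\<close> is continuous, adapted, \<open>M\<close>-valued and
  \<open>df(x) = (\<L> f)(x) dt + \<nabla>f(x) \<bullet> b(x) dW\<close> for every smooth \<open>f\<close> on \<open>M\<close>. On an open set \<open>M\<close> the
  coordinate functions give back the usual integral equation.\<close>

definition sde_solution ::
  "'w measure \<Rightarrow> (real \<Rightarrow> 'w measure) \<Rightarrow> (real \<Rightarrow> 'w \<Rightarrow> real^'m) \<Rightarrow> (real^'n) set \<Rightarrow>
   (real^'n \<Rightarrow> real^'n) \<Rightarrow> (real^'n \<Rightarrow> real^'m^'n) \<Rightarrow> (real \<Rightarrow> 'w \<Rightarrow> real^'n) \<Rightarrow> bool" where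
  "sde_solution P F W M a b x \<longleftrightarrow>
     (\<forall>t\<ge>0. x t \<in> borel_measurable (F t)) \<and>
     (\<forall>t\<ge>0. \<forall>\<omega>\<in>space P. x t \<omega> \<in> M) \<and>
     (\<forall>\<omega>\<in>space P. continuous_on {0..} (\<lambda>t. x t \<omega>)) \<and>
     (\<forall>f. (\<forall>k. C_k_manifold k M f) \<longrightarrow> (\<forall>T\<ge>0.
        (AE \<omega> in P. set_integrable lborel {0..T} (\<lambda>s. generator M a b f (x s \<omega>))) \<and>
        has_ito_integral P F W T
          (\<lambda>s \<omega>. transpose (b (x s \<omega>)) *v grad M f (x s \<omega>))
          (\<lambda>\<omega>. f (x T \<omega>) - f (x 0 \<omega>) - (LINT s:{0..T}|lborel. generator M a b f (x s \<omega>)))))"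

definition shifted_path :: "(real \<Rightarrow> 'w \<Rightarrow> 's) \<Rightarrow> real \<Rightarrow> 'w \<Rightarrow> real \<Rightarrow> 's" where
  "shifted_path x h \<omega> = (\<lambda>t\<in>{0..}. x (t + h) \<omega>)"

definition stationary_process ::
  "'w measure \<Rightarrow> (real \<Rightarrow> 'w \<Rightarrow> 's::topological_space) \<Rightarrow> bool" where
  "stationary_process P x \<longleftrightarrow>
     (\<forall>t\<ge>0. x t \<in> borel_measurable P) \<and>
     (\<forall>h\<ge>0. distr P (Pi\<^sub>M {0..} (\<lambda>_. borel)) (shifted_path x h) =
            distr P (Pi\<^sub>M {0..} (\<lambda>_. borel)) (shifted_path x 0))"

text \<open>Ergodicity of a stationary process under time shifts. Invariance has to be understood up to
  null sets: an event in the product \<open>\<sigma>\<close>-algebra depends on countably many times only, so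
  the events that are strictly invariant under all shifts are trivial for every process.\<close>

definition ergodic_process ::
  "'w measure \<Rightarrow> (real \<Rightarrow> 'w \<Rightarrow> 's::topological_space) \<Rightarrow> bool" where
  "ergodic_process P x \<longleftrightarrow>
     (\<forall>A\<in>sets (Pi\<^sub>M {0..} (\<lambda>_. borel)).
        (\<forall>h\<ge>0. AE \<omega> in P. shifted_path x h \<omega> \<in> A \<longleftrightarrow> shifted_path x 0 \<omega> \<in> A) \<longrightarrow>
        measure P {\<omega> \<in> space P. shifted_path x 0 \<omega> \<in> A} \<in> {0, 1})"

text \<open>The Feynman--Kac representation \<open>e\<^sup>t\<^sup>\<L> f (q) = E[f(x(s+t)) | x(s) = q]\<close>, for all \<open>s \<ge> 0\<close>.
  The conditional expectation given a value is the function \<open>u\<close> on the state space for which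
  \<open>u(x(s))\<close> is a version of the conditional expectation given \<open>\<sigma>(x(s))\<close>; it is determined almost
  everywhere with respect to the law of \<open>x(s)\<close>.\<close>

definition semigroup_solution ::
  "'w measure \<Rightarrow> 's measure \<Rightarrow> (real \<Rightarrow> 'w \<Rightarrow> 's) \<Rightarrow> real \<Rightarrow> ('s \<Rightarrow> real) \<Rightarrow> 's \<Rightarrow> real" where
  "semigroup_solution P S x t f =
     (SOME u. u \<in> borel_measurable S \<and>
        (\<forall>s\<ge>0. AE \<omega> in P.
           u (x s \<omega>) =
             real_cond_exp P (vimage_algebra (space P) (x s) S) (\<lambda>\<omega>'. f (x (s + t) \<omega>')) \<omega>))"

section \<open>The weighted space of square integrable functions and its eigenbasis\<close>

definition inner_p :: "'s measure \<Rightarrow> ('s \<Rightarrow> real) \<Rightarrow> ('s \<Rightarrow> real) \<Rightarrow> ('s \<Rightarrow> real) \<Rightarrow> real" where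
  "inner_p dV p f g = (LINT q|dV. f q * g q * p q)"

definition in_L2_p :: "'s measure \<Rightarrow> ('s \<Rightarrow> real) \<Rightarrow> ('s \<Rightarrow> real) \<Rightarrow> bool" where
  "in_L2_p dV p f \<longleftrightarrow> f \<in> borel_measurable dV \<and> integrable dV (\<lambda>q. (f q)\<^sup>2 * p q)"

definition orthonormal_basis_L2_p ::
  "'s measure \<Rightarrow> ('s \<Rightarrow> real) \<Rightarrow> (nat \<Rightarrow> 's \<Rightarrow> real) \<Rightarrow> bool" where
  "orthonormal_basis_L2_p dV p \<phi> \<longleftrightarrow>
     (\<forall>j\<ge>1. in_L2_p dV p (\<phi> j)) \<and>
     (\<forall>i\<ge>1. \<forall>j\<ge>1. inner_p dV p (\<phi> i) (\<phi> j) = (if i = j then 1 else 0)) \<and>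
     (\<forall>f. in_L2_p dV p f \<longrightarrow>
        (\<lambda>m. LINT q|dV. (f q - (\<Sum>j=1..m. inner_p dV p f (\<phi> j) * \<phi> j q))\<^sup>2 * p q) \<longlonglongrightarrow> 0)"

definition L_hat :: "(real^'n) set \<Rightarrow> (real^'n \<Rightarrow> real) \<Rightarrow> (real^'n \<Rightarrow> real) \<Rightarrow> real^'n \<Rightarrow> real" where
  "L_hat M p f q = laplacian M f q - grad M (\<lambda>q. - ln (p q)) q \<bullet> grad M f q"

definition eigenfunction_L_hat ::
  "(real^'n) set \<Rightarrow> (real^'n \<Rightarrow> real) \<Rightarrow> (real^'n \<Rightarrow> real) \<Rightarrow> bool" where
  "eigenfunction_L_hat M p f \<longleftrightarrow>
     C_k_manifold 2 M f \<and> (\<exists>q\<in>M. f q \<noteq> 0) \<and> (\<exists>c. \<forall>q\<in>M. L_hat M p f q = c * f q)"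

definition A_coeff ::
  "'w measure \<Rightarrow> 's measure \<Rightarrow> ('s \<Rightarrow> real) \<Rightarrow> (real \<Rightarrow> 'w \<Rightarrow> 's) \<Rightarrow> (nat \<Rightarrow> 's \<Rightarrow> real) \<Rightarrow>
   nat \<Rightarrow> nat \<Rightarrow> real \<Rightarrow> real" where
  "A_coeff P dV p x \<phi> l j \<tau> = inner_p dV p (\<phi> j) (semigroup_solution P dV x \<tau> (\<phi> l))"

definition A_hat ::
  "(real \<Rightarrow> 'w \<Rightarrow> 's) \<Rightarrow> (nat \<Rightarrow> real) \<Rightarrow> nat \<Rightarrow> (nat \<Rightarrow> 's \<Rightarrow> real) \<Rightarrow> nat \<Rightarrow> nat \<Rightarrow> 'w \<Rightarrow> real" where
  "A_hat x t N \<phi> l j \<omega> = 1 / real N * (\<Sum>i=1..N. \<phi> j (x (t i) \<omega>) * \<phi> l (x (t (i + 1)) \<omega>))"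

end

theory Submission
  imports Defs
begin

text \<open>By stationarity the law of \<open>(x(s), x(s + \<tau>))\<close> does not depend on \<open>s\<close>, so one function \<open>u\<close>
  serves as the regression function of \<open>\<phi>\<^sub>l(x(s + \<tau>))\<close> on \<open>x(s)\<close> for every \<open>s\<close>; hence the choice
  defining the semigroup is not vacuous. The tower property and the density \<open>p\<^sub>e\<^sub>q\<close> of \<open>x(s)\<close> turn each
  summand's expectation \<open>E[\<phi>\<^sub>j(x(s)) \<phi>\<^sub>l(x(s + \<tau>))] = E[\<phi>\<^sub>j(x(s)) u(x(s))]\<close> into
  \<open>\<integral> \<phi>\<^sub>j u p\<^sub>e\<^sub>q dV\<close>.\<close>

section \<open>Laws on a subspace and two-time laws of a stationary process\<close>

lemma measurable_restrict_space_codomain: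
  assumes f: "f \<in> measurable P N" "\<And>\<omega>. \<omega> \<in> space P \<Longrightarrow> f \<omega> \<in> \<Omega>"
    and id: "(\<lambda>z. z) \<in> measurable (restrict_space N \<Omega>) K"
  shows "f \<in> measurable P K"
proof -
  have "f \<in> measurable P (restrict_space N \<Omega>)"
    using f by (intro measurable_restrict_space2) auto
  from measurable_compose[OF this id] show ?thesis by simp
qed

text \<open>This carries equal laws from the ambient Borel sets, where stationarity is formulated,
  to the trace \<sigma>-algebra of a subset such as the manifold. On \<open>\<Omega>\<close> every
  set of \<open>K\<close> agrees with some set of \<open>N\<close>, and since \<open>f\<close> and
  \<open>g\<close> take values in \<open>\<Omega>\<close>, the two sets have the same
  preimage.\<close>

lemma distr_eq_restrict_codomain:
  assumes f: "f \<in> measurable P N" "\<And>\<omega>. \<omega> \<in> space P \<Longrightarrow> f \<omega> \<in> \<Omega>"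
    and g: "g \<in> measurable P N" "\<And>\<omega>. \<omega> \<in> space P \<Longrightarrow> g \<omega> \<in> \<Omega>"
    and eq: "distr P N f = distr P N g"
    and id: "(\<lambda>z. z) \<in> measurable (restrict_space N \<Omega>) K"
  shows "distr P K f = distr P K g"
proof (rule measure_eqI)
  fix A assume "A \<in> sets (distr P K f)"
  then have A: "A \<in> sets K" by simp
  have "(\<lambda>z. z) -` A \<inter> space (restrict_space N \<Omega>) \<in> sets (restrict_space N \<Omega>)"
    using id A by (rule measurable_sets)
  then obtain B where B: "B \<in> sets N" "A \<inter> (\<Omega> \<inter> space N) = \<Omega> \<inter> B"
    by (auto simp: sets_restrict_space space_restrict_space)
  have pre: "h -` A \<inter> space P = h -` B \<inter> space P"
    if "h \<in> measurable P N" "\<And>\<omega>. \<omega> \<in> space P \<Longrightarrow> h \<omega> \<in> \<Omega>" for h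
    using B(2) that measurable_space[OF that(1)] by auto
  have "emeasure (distr P K f) A = emeasure (distr P N f) B"
    using pre[OF f] B A f measurable_restrict_space_codomain[OF f id] by (simp add: emeasure_distr)
  also have "\<dots> = emeasure (distr P K g) A"
    using pre[OF g] B A g measurable_restrict_space_codomain[OF g id] by (simp add: eq emeasure_distr)
  finally show "emeasure (distr P K f) A = emeasure (distr P K g) A" .
qed simp

text \<open>Stationarity equates the laws of whole paths. Evaluation at the times \<open>0\<close>
  and \<open>t\<close> is measurable on the path space, so the two-time laws are images of the path
  laws.\<close>

lemma stationary_process_pair_law:
  fixes x :: "real \<Rightarrow> 'w \<Rightarrow> 's::topological_space"
  assumes "stationary_process P x" and s: "s \<ge> 0" and t: "t \<ge> 0"
  shows "distr P (borel \<Otimes>\<^sub>M borel) (\<lambda>\<omega>. (x s \<omega>, x (s + t) \<omega>)) =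
    distr P (borel \<Otimes>\<^sub>M borel) (\<lambda>\<omega>. (x 0 \<omega>, x t \<omega>))"
proof -
  let ?PM = "Pi\<^sub>M {0..} (\<lambda>_. borel) :: (real \<Rightarrow> 's) measure"
  let ?\<pi> = "\<lambda>w :: real \<Rightarrow> 's. (w 0, w t)"
  have x: "x r \<in> borel_measurable P" if "r \<ge> 0" for r
    using assms(1) that by (auto simp: stationary_process_def)
  have \<pi>: "?\<pi> \<in> measurable ?PM (borel \<Otimes>\<^sub>M borel)"
    using t by (intro measurable_Pair measurable_component_singleton) auto
  have shift: "shifted_path x h \<in> measurable P ?PM" if "h \<ge> 0" for h
  proof -
    have "(\<lambda>\<omega>. \<lambda>r\<in>{0..}. x (r + h) \<omega>) \<in> measurable P ?PM"
      using x that by (intro measurable_restrict) auto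
    then show ?thesis by (simp add: shifted_path_def[abs_def])
  qed
  \<comment> \<open>Both evaluation times lie in \<open>{0..}\<close>, where a shifted path is not
    replaced by the default value of a restricted function.\<close>
  have pair: "distr (distr P ?PM (shifted_path x h)) (borel \<Otimes>\<^sub>M borel) ?\<pi> =
      distr P (borel \<Otimes>\<^sub>M borel) (\<lambda>\<omega>. (x h \<omega>, x (h + t) \<omega>))" if "h \<ge> 0" for h
    using t by (simp add: distr_distr[OF \<pi> shift[OF that]] comp_def shifted_path_def add.commute)
  have "distr P ?PM (shifted_path x s) = distr P ?PM (shifted_path x 0)"
    using assms(1) s unfolding stationary_process_def by blast
  with pair[OF s] pair[of 0] show ?thesis by simp
qed

section \<open>Regression functions and conditional expectations\<close>

lemma finite_measure_subalgebra_vimage: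
  assumes "prob_space P" "X \<in> measurable P S"
  shows "finite_measure_subalgebra P (vimage_algebra (space P) X S)"
proof -
  interpret prob_space P by fact
  show ?thesis
    by unfold_locales
      (auto simp: subalgebra_def intro!: sets_image_in_sets[OF _ assms(2)])
qed

text \<open>A Doob-Dynkin factorization, carried out on the product space rather than on
  \<open>P\<close>, so that \<open>u\<close> depends on the joint law alone. There the first
  coordinate is onto \<open>space S\<close>, whereas the values of a random variable on
  \<open>P\<close> may miss points at which \<open>u\<close> has to be defined.\<close>

lemma regression_function_exists:
  fixes f :: "'s \<Rightarrow> real"
  assumes Q: "prob_space Q" and sets_Q: "sets Q = sets (S \<Otimes>\<^sub>M S)"
    and f: "f \<in> borel_measurable S" "integrable Q (\<lambda>z. f (snd z))"
  obtains u where "u \<in> borel_measurable S" "integrable Q (\<lambda>z. u (fst z))"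
    "\<And>A. A \<in> sets S \<Longrightarrow>
      (\<integral>z. indicator A (fst z) * f (snd z) \<partial>Q) = (\<integral>z. indicator A (fst z) * u (fst z) \<partial>Q)"
proof -
  interpret Q: prob_space Q by fact
  let ?H = "vimage_algebra (space Q) fst S"
  let ?g = "real_cond_exp Q ?H (\<lambda>z. f (snd z))"
  have space_Q: "space Q = space S \<times> space S"
    using sets_eq_imp_space_eq[OF sets_Q] by (simp add: space_pair_measure)
  have fst: "fst \<in> measurable Q S"
    by (simp add: measurable_cong_sets[OF sets_Q refl])
  interpret H: finite_measure_subalgebra Q ?H
    by (rule finite_measure_subalgebra_vimage[OF Q fst])
  obtain q0 where q0: "q0 \<in> space S"
    using Q.not_empty space_Q by auto
  \<comment> \<open>The point \<open>q0\<close> is arbitrary. The section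
    \<open>q \<mapsto> (q, q0)\<close> is measurable into \<open>?H\<close> because its first
    coordinate is the identity.\<close>
  define u where "u = (\<lambda>q. ?g (q, q0))"
  have g: "?g \<in> borel_measurable ?H" by simp
  have u: "u \<in> borel_measurable S"
    unfolding u_def using q0
    by (intro measurable_compose[OF _ g] measurable_vimage_algebra2) (auto simp: space_Q)
  \<comment> \<open>A function measurable with respect to the first coordinate only is constant on its fibres.\<close>
  have gu: "?g z = u (fst z)" if z: "z \<in> space Q" for z
  proof -
    have "?g -` {?g z} \<inter> space ?H \<in> sets ?H"
      by (rule measurable_sets[OF g]) simp
    moreover have "fst \<in> space Q \<rightarrow> space S" by (auto simp: space_Q)
    ultimately obtain A where A: "?g -` {?g z} \<inter> space Q = fst -` A \<inter> space Q"
      by (auto simp: sets_vimage_algebra2)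
    have "z \<in> fst -` A \<inter> space Q" using A z by blast
    then have "(fst z, q0) \<in> fst -` A \<inter> space Q"
      using q0 by (auto simp: space_Q)
    then have "?g (fst z, q0) = ?g z" unfolding A[symmetric] by blast
    then show ?thesis by (simp add: u_def)
  qed
  show ?thesis
  proof
    show "u \<in> borel_measurable S" by fact
    show "integrable Q (\<lambda>z. u (fst z))"
      using H.real_cond_exp_int(1)[OF f(2)] gu by (simp cong: Bochner_Integration.integrable_cong)
    fix A assume A: "A \<in> sets S"
    have "(\<integral>z. indicator A (fst z) * f (snd z) \<partial>Q) = (\<integral>z. indicator A (fst z) * ?g z \<partial>Q)"
    proof (rule H.real_cond_exp_intg(2)[symmetric])
      have "fst \<in> measurable ?H S"
        by (rule measurable_vimage_algebra1) (auto simp: space_Q)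
      then show "(\<lambda>z. indicator A (fst z) :: real) \<in> borel_measurable ?H"
        using A by measurable
      show "(\<lambda>z. f (snd z)) \<in> borel_measurable Q" using f(2) by simp
      have "integrable Q (\<lambda>z. indicator (fst -` A \<inter> space Q) z *\<^sub>R f (snd z))"
        using fst A by (intro integrable_mult_indicator f(2)) auto
      then show "integrable Q (\<lambda>z. indicator A (fst z) * f (snd z))"
        by (rule Bochner_Integration.integrable_cong[THEN iffD1, rotated -1])
          (auto simp: indicator_def)
    qed
    also have "\<dots> = (\<integral>z. indicator A (fst z) * u (fst z) \<partial>Q)"
      using gu by (simp cong: Bochner_Integration.integral_cong)
    finally show "(\<integral>z. indicator A (fst z) * f (snd z) \<partial>Q) =
      (\<integral>z. indicator A (fst z) * u (fst z) \<partial>Q)" .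
  qed
qed

text \<open>Sets of the \<sigma>-algebra generated by \<open>X\<close> are preimages under
  \<open>X\<close>, so the integrals that characterize the conditional expectation involve only the
  joint law of \<open>X\<close> and \<open>Y\<close>. Keeping that law as a fixed \<open>Q\<close>
  lets one \<open>u\<close> serve every pair with law \<open>Q\<close>.\<close>

lemma regression_function_cond_exp:
  fixes f u :: "'s \<Rightarrow> real"
  assumes P: "prob_space P" and X: "X \<in> measurable P S" and Y: "Y \<in> measurable P S"
    and Q: "distr P (S \<Otimes>\<^sub>M S) (\<lambda>\<omega>. (X \<omega>, Y \<omega>)) = Q"
    and f: "f \<in> borel_measurable S" "integrable Q (\<lambda>z. f (snd z))"
    and u: "u \<in> borel_measurable S" "integrable Q (\<lambda>z. u (fst z))"
    and eq: "\<And>A. A \<in> sets S \<Longrightarrow>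
      (\<integral>z. indicator A (fst z) * f (snd z) \<partial>Q) = (\<integral>z. indicator A (fst z) * u (fst z) \<partial>Q)"
  shows "AE \<omega> in P. u (X \<omega>) =
    real_cond_exp P (vimage_algebra (space P) X S) (\<lambda>\<omega>. f (Y \<omega>)) \<omega>"
proof -
  let ?F = "vimage_algebra (space P) X S"
  interpret F: finite_measure_subalgebra P ?F
    by (rule finite_measure_subalgebra_vimage[OF P X])
  note [measurable] = X Y f(1) u(1)
  have XS: "X \<in> space P \<rightarrow> space S" using measurable_space[OF X] by auto
  have "AE \<omega> in P. real_cond_exp P ?F (\<lambda>\<omega>. f (Y \<omega>)) \<omega> = u (X \<omega>)"
  proof (rule F.real_cond_exp_charact)
    show "integrable P (\<lambda>\<omega>. f (Y \<omega>))"
      using f(2) unfolding Q[symmetric] by (subst (asm) integrable_distr_eq) auto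
    show "integrable P (\<lambda>\<omega>. u (X \<omega>))"
      using u(2) unfolding Q[symmetric] by (subst (asm) integrable_distr_eq) auto
    show "(\<lambda>\<omega>. u (X \<omega>)) \<in> borel_measurable ?F"
      by (rule measurable_compose[OF measurable_vimage_algebra1[OF XS] u(1)])
    fix B assume "B \<in> sets ?F"
    then obtain A where [measurable]: "A \<in> sets S" and B: "B = X -` A \<inter> space P"
      by (auto simp: sets_vimage_algebra2[OF XS])
    have B_int: "(\<integral>\<omega>\<in>B. h \<omega> \<partial>P) = (\<integral>\<omega>. indicator A (X \<omega>) * h \<omega> \<partial>P)" for h :: "_ \<Rightarrow> real"
      unfolding set_lebesgue_integral_def
      by (rule Bochner_Integration.integral_cong) (auto simp: B indicator_def)
    have "(\<integral>\<omega>. indicator A (X \<omega>) * f (Y \<omega>) \<partial>P) = (\<integral>z. indicator A (fst z) * f (snd z) \<partial>Q)"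
      unfolding Q[symmetric] by (subst integral_distr) auto
    also have "\<dots> = (\<integral>\<omega>. indicator A (X \<omega>) * u (X \<omega>) \<partial>P)"
      unfolding eq[OF \<open>A \<in> sets S\<close>] unfolding Q[symmetric] by (subst integral_distr) auto
    finally show "(\<integral>\<omega>\<in>B. f (Y \<omega>) \<partial>P) = (\<integral>\<omega>\<in>B. u (X \<omega>) \<partial>P)"
      by (simp only: B_int)
  qed
  then show ?thesis by eventually_elim simp
qed

text \<open>The choice in \<open>semigroup_solution\<close> is informative only if a single function
  works for all \<open>s\<close> at once. The regression function of the pair at time
  \<open>0\<close> does, since by \<open>law\<close> all pairs with lag \<open>t\<close> share one
  distribution.\<close>

lemma semigroup_solution_cond_exp:
  fixes f :: "'s \<Rightarrow> real"
  assumes P: "prob_space P" and x: "\<And>s. s \<ge> 0 \<Longrightarrow> x s \<in> measurable P S" and t: "t \<ge> 0"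
    and law: "\<And>s. s \<ge> 0 \<Longrightarrow> distr P (S \<Otimes>\<^sub>M S) (\<lambda>\<omega>. (x s \<omega>, x (s + t) \<omega>)) =
      distr P (S \<Otimes>\<^sub>M S) (\<lambda>\<omega>. (x 0 \<omega>, x t \<omega>))"
    and f: "f \<in> borel_measurable S" "integrable P (\<lambda>\<omega>. f (x t \<omega>))"
  shows "semigroup_solution P S x t f \<in> borel_measurable S" (is ?meas)
    and "s \<ge> 0 \<Longrightarrow> AE \<omega> in P. semigroup_solution P S x t f (x s \<omega>) =
      real_cond_exp P (vimage_algebra (space P) (x s) S) (\<lambda>\<omega>'. f (x (s + t) \<omega>')) \<omega>"
proof -
  let ?Q = "distr P (S \<Otimes>\<^sub>M S) (\<lambda>\<omega>. (x 0 \<omega>, x t \<omega>))"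
  note [measurable] = x[of 0, simplified] x[OF t] f(1)
  have Q: "prob_space ?Q"
    by (rule prob_space.prob_space_distr[OF P]) measurable
  have fQ: "integrable ?Q (\<lambda>z. f (snd z))"
    using f(2) by (subst integrable_distr_eq) auto
  obtain u where u: "u \<in> borel_measurable S" "integrable ?Q (\<lambda>z. u (fst z))"
    "\<And>A. A \<in> sets S \<Longrightarrow>
      (\<integral>z. indicator A (fst z) * f (snd z) \<partial>?Q) = (\<integral>z. indicator A (fst z) * u (fst z) \<partial>?Q)"
    using regression_function_exists[OF Q sets_distr f(1) fQ] by blast
  let ?C = "\<lambda>u. u \<in> borel_measurable S \<and> (\<forall>s\<ge>0. AE \<omega> in P. u (x s \<omega>) =
    real_cond_exp P (vimage_algebra (space P) (x s) S) (\<lambda>\<omega>'. f (x (s + t) \<omega>')) \<omega>)"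
  have "?C u"
    using u t by (auto intro!: regression_function_cond_exp[OF P x x law f(1) fQ])
  \<comment> \<open>The chosen function may differ from \<open>u\<close>; it only inherits the
    property \<open>?C\<close>.\<close>
  then have "?C (semigroup_solution P S x t f)"
    unfolding semigroup_solution_def by (rule someI[where P = ?C])
  then show ?meas and "s \<ge> 0 \<Longrightarrow> AE \<omega> in P. semigroup_solution P S x t f (x s \<omega>) =
      real_cond_exp P (vimage_algebra (space P) (x s) S) (\<lambda>\<omega>'. f (x (s + t) \<omega>')) \<omega>"
    by auto
qed

section \<open>Two-time correlations as weighted inner products\<close>

lemma integrable_mult_of_square_integrable:
  fixes f g :: "'a \<Rightarrow> real"
  assumes "f \<in> borel_measurable M" "g \<in> borel_measurable M"
    and "integrable M (\<lambda>x. (f x)\<^sup>2)" "integrable M (\<lambda>x. (g x)\<^sup>2)"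
  shows "integrable M (\<lambda>x. f x * g x)"
proof (rule Bochner_Integration.integrable_bound)
  show "integrable M (\<lambda>x. (f x)\<^sup>2 + (g x)\<^sup>2)" using assms by simp
  have "\<bar>f x * g x\<bar> \<le> (f x)\<^sup>2 + (g x)\<^sup>2" for x
  proof -
    have "2 * \<bar>f x * g x\<bar> \<le> (f x)\<^sup>2 + (g x)\<^sup>2"
      using sum_squares_bound[of "\<bar>f x\<bar>" "\<bar>g x\<bar>"] by (simp add: abs_mult)
    then show ?thesis by linarith
  qed
  then show "AE x in M. norm (f x * g x) \<le> norm ((f x)\<^sup>2 + (g x)\<^sup>2)"
    by (simp add: abs_of_nonneg)
qed (use assms in measurable)

text \<open>Membership in the weighted space means a finite second moment under the law of each
  \<open>x r\<close>. This makes the product integrable, as needed to pull the factor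
  \<open>g (x s \<omega>)\<close>, measurable with respect to \<open>x s\<close>, out of the
  conditional expectation.\<close>

lemma correlation_eq_inner_p_semigroup:
  fixes f g :: "'s \<Rightarrow> real"
  assumes P: "prob_space P" and t: "t \<ge> 0" and s: "s \<ge> 0"
    and dens: "\<And>s. s \<ge> 0 \<Longrightarrow> distributed P S (x s) (\<lambda>q. ennreal (p q))"
    and nonneg: "\<And>q. q \<in> space S \<Longrightarrow> p q \<ge> 0"
    and law: "\<And>s. s \<ge> 0 \<Longrightarrow> distr P (S \<Otimes>\<^sub>M S) (\<lambda>\<omega>. (x s \<omega>, x (s + t) \<omega>)) =
      distr P (S \<Otimes>\<^sub>M S) (\<lambda>\<omega>. (x 0 \<omega>, x t \<omega>))"
    and f: "in_L2_p S p f" and g: "in_L2_p S p g"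
  shows "integrable P (\<lambda>\<omega>. g (x s \<omega>) * f (x (s + t) \<omega>))"
    and "(\<integral>\<omega>. g (x s \<omega>) * f (x (s + t) \<omega>) \<partial>P) =
      inner_p S p g (semigroup_solution P S x t f)"
proof -
  interpret prob_space P by fact
  have x: "x r \<in> measurable P S" if "r \<ge> 0" for r
    using dens[OF that] by (rule distributed_measurable)
  have L2: "integrable P (\<lambda>\<omega>. (h (x r \<omega>))\<^sup>2)" if "in_L2_p S p h" "r \<ge> 0" for h r
    using that distributed_integrable[OF dens[OF that(2)], of "\<lambda>q. (h q)\<^sup>2"] nonneg
    by (auto simp: in_L2_p_def mult.commute)
  have fS: "f \<in> borel_measurable S" and gS: "g \<in> borel_measurable S"
    using f g by (auto simp: in_L2_p_def)
  have st: "s + t \<ge> 0" using s t by simp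
  have fx: "(\<lambda>\<omega>. f (x r \<omega>)) \<in> borel_measurable P" and gx: "(\<lambda>\<omega>. g (x r \<omega>)) \<in> borel_measurable P"
    if "r \<ge> 0" for r
    using measurable_compose[OF x[OF that]] fS gS by auto
  show int: "integrable P (\<lambda>\<omega>. g (x s \<omega>) * f (x (s + t) \<omega>))"
    using s st by (intro integrable_mult_of_square_integrable L2 f g fx gx)
  let ?u = "semigroup_solution P S x t f"
  let ?F = "vimage_algebra (space P) (x s) S"
  \<comment> \<open>On a probability space square integrability implies integrability. Time
    \<open>t\<close> is the later time of the reference pair starting at \<open>0\<close>.\<close>
  have fxt: "integrable P (\<lambda>\<omega>. f (x t \<omega>))"
    using square_integrable_imp_integrable[OF fx L2[OF f]] t by simp
  have u: "?u \<in> borel_measurable S"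
    "AE \<omega> in P. ?u (x s \<omega>) = real_cond_exp P ?F (\<lambda>\<omega>. f (x (s + t) \<omega>)) \<omega>"
    by (rule semigroup_solution_cond_exp[OF P x t law fS fxt]; simp add: s)+
  interpret F: finite_measure_subalgebra P ?F
    by (rule finite_measure_subalgebra_vimage[OF P x[OF s]])
  have "x s \<in> measurable ?F S"
    using measurable_space[OF x[OF s]] by (intro measurable_vimage_algebra1) auto
  then have "(\<integral>\<omega>. g (x s \<omega>) * f (x (s + t) \<omega>) \<partial>P) =
      (\<integral>\<omega>. g (x s \<omega>) * real_cond_exp P ?F (\<lambda>\<omega>. f (x (s + t) \<omega>)) \<omega> \<partial>P)"
    using int fx[OF st] gS by (intro F.real_cond_exp_intg(2)[symmetric]) auto
  \<comment> \<open>The chosen function represents the conditional expectation almost everywhere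
    only, which suffices under the integral.\<close>
  also have "\<dots> = (\<integral>\<omega>. g (x s \<omega>) * ?u (x s \<omega>) \<partial>P)"
  proof (rule integral_cong_AE)
    show "(\<lambda>\<omega>. g (x s \<omega>) * real_cond_exp P ?F (\<lambda>\<omega>. f (x (s + t) \<omega>)) \<omega>) \<in> borel_measurable P"
      by (intro borel_measurable_times gx[OF s] borel_measurable_cond_exp2)
    show "(\<lambda>\<omega>. g (x s \<omega>) * ?u (x s \<omega>)) \<in> borel_measurable P"
      by (intro borel_measurable_times gx[OF s] measurable_compose[OF x[OF s] u(1)])
    show "AE \<omega> in P. g (x s \<omega>) * real_cond_exp P ?F (\<lambda>\<omega>. f (x (s + t) \<omega>)) \<omega> =
        g (x s \<omega>) * ?u (x s \<omega>)"
      using u(2) by eventually_elim simp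
  qed
  \<comment> \<open>Change of variables to the density of \<open>x s\<close>, valid for any
    measurable integrand as \<open>p\<close> is nonnegative on \<open>space S\<close>.\<close>
  also have "\<dots> = (\<integral>q. p q * (g q * ?u q) \<partial>S)"
    using distributed_integral[OF dens[OF s], of "\<lambda>q. g q * ?u q"] nonneg gS u(1) by simp
  also have "\<dots> = inner_p S p g ?u"
    by (simp add: inner_p_def mult.commute)
  finally show "(\<integral>\<omega>. g (x s \<omega>) * f (x (s + t) \<omega>) \<partial>P) = inner_p S p g ?u" .
qed

section \<open>Unbiasedness of the estimator\<close>

theorem mainTheorem2:
  fixes M :: "(real^'n) set"
    and dV :: "(real^'n) measure"
    and P :: "'w measure"
    and F :: "real \<Rightarrow> 'w measure"
    and W :: "real \<Rightarrow> 'w \<Rightarrow> real^'m"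
    and a :: "real^'n \<Rightarrow> real^'n"
    and b :: "real^'n \<Rightarrow> real^'m^'n"
    and x :: "real \<Rightarrow> 'w \<Rightarrow> real^'n"
    and p_eq :: "real^'n \<Rightarrow> real"
    and \<phi> :: "nat \<Rightarrow> real^'n \<Rightarrow> real"
    and t :: "nat \<Rightarrow> real"
    and \<tau> :: real
    and N :: nat
  assumes manifold: "embedded_submanifold TYPE('d::finite) M"
    and volume: "riemannian_volume TYPE('d) M dV"
    and prob: "prob_space P"
    and filt: "filtration (space P) F" "\<And>s. sets (F s) \<subseteq> sets P"
    and brownian: "brownian_motion P F W"
    and vector_field: "a \<in> borel_measurable (restrict_space borel M)"
      "\<And>q. q \<in> M \<Longrightarrow> a q \<in> tangent_space M q"
    and diffusion_tensor: "b \<in> borel_measurable (restrict_space borel M)"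
      "\<And>q k. q \<in> M \<Longrightarrow> column k (b q) \<in> tangent_space M q"
    and solution: "sde_solution P F W M a b x"
    and stationary: "stationary_process P x"
    and ergodic: "ergodic_process P x"
    and density_regular: "C_k_manifold 1 M p_eq" "\<And>q. q \<in> M \<Longrightarrow> p_eq q > 0"
    and invariant_density: "\<And>s. s \<ge> 0 \<Longrightarrow> distributed P dV (x s) (\<lambda>q. ennreal (p_eq q))"
    and eigenfunctions: "\<And>j. j \<ge> 1 \<Longrightarrow> eigenfunction_L_hat M p_eq (\<phi> j)"
    and orthonormal_basis: "orthonormal_basis_L2_p dV p_eq \<phi>"
    and "N \<ge> 1"
    and "\<tau> > 0"
    and times: "t 1 \<ge> 0" "\<And>i. i \<in> {1..N} \<Longrightarrow> t (i + 1) - t i = \<tau>"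
  shows "\<forall>l\<ge>1. \<forall>j\<ge>1.
    integrable P (A_hat x t N \<phi> l j) \<and>
    prob_space.expectation P (A_hat x t N \<phi> l j) = A_coeff P dV p_eq x \<phi> l j \<tau>"
proof (intro allI impI)
  fix l j :: nat
  assume "l \<ge> 1" "j \<ge> 1"
  with orthonormal_basis have L2: "in_L2_p dV p_eq (\<phi> l)" "in_L2_p dV p_eq (\<phi> j)"
    by (auto simp: orthonormal_basis_L2_p_def)
  have space_dV: "space dV = M" and sets_dV: "sets dV = sets (restrict_space borel M)"
    using volume by (auto simp: riemannian_volume_def)
  have \<tau>: "\<tau> \<ge> 0" using \<open>\<tau> > 0\<close> by simp
  have x_dV: "x s \<in> measurable P dV" if "s \<ge> 0" for s
    using invariant_density[OF that] by (rule distributed_measurable)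
  have x_borel: "x s \<in> borel_measurable P" if "s \<ge> 0" for s
    using stationary that by (auto simp: stationary_process_def)
  have law: "distr P (dV \<Otimes>\<^sub>M dV) (\<lambda>\<omega>. (x s \<omega>, x (s + \<tau>) \<omega>)) =
      distr P (dV \<Otimes>\<^sub>M dV) (\<lambda>\<omega>. (x 0 \<omega>, x \<tau> \<omega>))" if s: "s \<ge> 0" for s
  proof (rule distr_eq_restrict_codomain[where \<Omega> = "M \<times> M"])
    show "distr P (borel \<Otimes>\<^sub>M borel) (\<lambda>\<omega>. (x s \<omega>, x (s + \<tau>) \<omega>)) =
        distr P (borel \<Otimes>\<^sub>M borel) (\<lambda>\<omega>. (x 0 \<omega>, x \<tau> \<omega>))"
      by (rule stationary_process_pair_law[OF stationary s \<tau>])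
    show "(\<lambda>\<omega>. (x s \<omega>, x (s + \<tau>) \<omega>)) \<in> measurable P (borel \<Otimes>\<^sub>M borel)"
      "(\<lambda>\<omega>. (x 0 \<omega>, x \<tau> \<omega>)) \<in> measurable P (borel \<Otimes>\<^sub>M borel)"
      using s \<tau> by (intro measurable_Pair x_borel; simp)+
    show "(x s \<omega>, x (s + \<tau>) \<omega>) \<in> M \<times> M" "(x 0 \<omega>, x \<tau> \<omega>) \<in> M \<times> M" if "\<omega> \<in> space P" for \<omega>
      using that s \<tau> x_dV[THEN measurable_space] by (auto simp: space_dV)
    let ?R = "restrict_space (borel \<Otimes>\<^sub>M borel) (M \<times> M) :: ((real^'n) \<times> (real^'n)) measure"
    \<comment> \<open>Both projections of \<open>M \<times> M\<close> land in \<open>M\<close>, and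
      \<open>dV\<close> carries the trace Borel sets of \<open>M\<close>; the identity is then
      measurable coordinatewise.\<close>
    have "fst \<in> measurable ?R dV" "snd \<in> measurable ?R dV"
      unfolding measurable_cong_sets[OF refl sets_dV]
      by (intro measurable_restrict_space2 measurable_restrict_space1;
          auto simp: space_restrict_space)+
    then show "(\<lambda>z. z) \<in> measurable ?R (dV \<Otimes>\<^sub>M dV)"
      by (subst measurable_pair_iff) (simp add: comp_def)
  qed
  \<comment> \<open>The process is controlled at nonnegative times only, so the sign of
    \<open>t 1\<close> is propagated along the constant spacing.\<close>
  have t_nonneg: "t i \<ge> 0" if "i \<in> {1..N}" for i
  proof -
    have "1 \<le> i" "i \<le> N" using that by auto
    then show ?thesis
    proof (induction i rule: dec_induct)
      case base
      show ?case by (rule times(1))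
    next
      case (step i)
      then have "t (i + 1) = t i + \<tau>" using times(2)[of i] by simp
      with step \<tau> show ?case by simp
    qed
  qed
  have summand: "integrable P (\<lambda>\<omega>. \<phi> j (x (t i) \<omega>) * \<phi> l (x (t (i + 1)) \<omega>))"
    "(\<integral>\<omega>. \<phi> j (x (t i) \<omega>) * \<phi> l (x (t (i + 1)) \<omega>) \<partial>P) = A_coeff P dV p_eq x \<phi> l j \<tau>"
    if i: "i \<in> {1..N}" for i
  proof -
    \<comment> \<open>With the later time in this form the summand is a correlation with lag
      \<open>\<tau>\<close>, whose value does not involve \<open>i\<close>.\<close>
    have step: "t (i + 1) = t i + \<tau>" using times(2)[OF i] by simp
    have pos: "p_eq q \<ge> 0" if "q \<in> space dV" for q
      using density_regular(2)[of q] that by (simp add: space_dV)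
    show "integrable P (\<lambda>\<omega>. \<phi> j (x (t i) \<omega>) * \<phi> l (x (t (i + 1)) \<omega>))"
      "(\<integral>\<omega>. \<phi> j (x (t i) \<omega>) * \<phi> l (x (t (i + 1)) \<omega>) \<partial>P) = A_coeff P dV p_eq x \<phi> l j \<tau>"
      unfolding step A_coeff_def
      by (rule correlation_eq_inner_p_semigroup
          [OF prob \<tau> t_nonneg[OF i] invariant_density pos law L2]; assumption)+
  qed
  have "integrable P (A_hat x t N \<phi> l j)"
    unfolding A_hat_def[abs_def] using summand(1)
    by (intro integrable_mult_right Bochner_Integration.integrable_sum) auto
  moreover have "prob_space.expectation P (A_hat x t N \<phi> l j) = A_coeff P dV p_eq x \<phi> l j \<tau>"
    \<comment> \<open>All \<open>N\<close> summands have the same expectation. Since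
      \<open>N \<ge> 1\<close>, the factor \<open>1 / real N\<close> cancels their number instead of
      being the default value \<open>0\<close> of a division by zero.\<close>
    unfolding A_hat_def[abs_def] using summand \<open>N \<ge> 1\<close>
    by (simp add: Bochner_Integration.integral_sum)
  ultimately show "integrable P (A_hat x t N \<phi> l j) \<and>
      prob_space.expectation P (A_hat x t N \<phi> l j) = A_coeff P dV p_eq x \<phi> l j \<tau>" ..
qed

end
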